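(* Let $h:\mathbb{R}\to\mathbb{R}$, let $\phi:\mathbb{R}\to\mathbb{R}_+$ be convex, and let $\varphi$ be the surrogate loss $$\varphi(\alpha,Y)=\sum_{i,j:\,Y_{ij}>0}\phi\bigl(\alpha_i-\alpha_j-h(Y_{ij})\bigr).$$ Then even in the low-noise setting $\varphi$ is not structure-consistent with respect to the pairwise loss $L$; that is, there exist a number of items $m$ and a low-noise probability measure $\mu$ on weighted adjacency matrices of directed acyclic graphs on $m$ nodes such that the strict inequality $$\inf_{\alpha\in\mathbb{R}^m}\ell_\varphi(\alpha,\mu)<\inf_{\alpha\in\mathbb{R}^m}\Bigl\{\ell_\varphi(\alpha,\mu)\ \Big|\ \alpha\notin\operatorname{argmin}_{\alpha'}\ell(\alpha',\mu)\Bigr\}$$ fails.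
   Context: A preference judgment is the weighted adjacency matrix $Y\in\mathbb{R}_+^{m\times m}$ of a weighted directed acyclic graph on nodes $\{1,\dots,m\}$: $Y_{ij}>0$ is the weight of the edge $i\to j$, and $Y_{ij}=0$ if there is no such edge. The structures are single judgments $Y$ (no aggregation). Pairwise loss: for $\alpha\in\mathbb{R}^m$, $L(\alpha,Y)=\sum_{i<j}Y_{ij}1(\alpha_i\le\alpha_j)+\sum_{i>j}Y_{ij}1(\alpha_i<\alpha_j)$. For a probability measure $\mu$ on such matrices, $\ell(\alpha,\mu)=\int L(\alpha,Y)\,d\mu(Y)$, $\ell_\varphi(\alpha,\mu)=\int\varphi(\alpha,Y)\,d\mu(Y)$, and $Y^\mu_{ij}=\int Y_{ij}\,d\mu(Y)$. Structure-consistency of $\varphi$ with respect to $L$ means that the displayed strict inequality holds for every $\mu$ (with $\inf\emptyset=+\infty$). Difference graph: $G_\mu$ is the directed graph on $\{1,\dots,m\}$ in which the edge $i\to j$ is present iff $Y^\mu_{ij}>Y^\mu_{ji}$, with weight $Y^\mu_{ij}-Y^\mu_{ji}$. Low-noise: $\mu$ is low-noise if whenever $i\to j$ and $j\to k$ are edges of $G_\mu$, the weight $Y^\mu_{ik}-Y^\mu_{ki}$ on the edge $i\to k$ is greater than or equal to $(Y^\mu_{ij}-Y^\mu_{ji})+(Y^\mu_{jk}-Y^\mu_{kj})$. *)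

theory Defs
  imports "HOL-Probability.Probability"
begin

text \<open>
  Score vectors in \<open>\<real>\<^sup>m\<close> and \<open>m \<times> m\<close> matrices are represented as extensional functions
  on \<open>{1..m}\<close> and \<open>{1..m} \<times> {1..m}\<close>, since \<open>m\<close> has to be quantified.
\<close>

definition scores :: "nat \<Rightarrow> (nat \<Rightarrow> real) set" where
  "scores m = {1..m} \<rightarrow>\<^sub>E UNIV"

definition judgments :: "nat \<Rightarrow> (nat \<times> nat \<Rightarrow> real) set" where
  "judgments m = {Y \<in> ({1..m} \<times> {1..m}) \<rightarrow>\<^sub>E {0..}.
     acyclic {e \<in> {1..m} \<times> {1..m}. Y e > 0}}"

definition judgment_space :: "nat \<Rightarrow> (nat \<times> nat \<Rightarrow> real) measure" where
  "judgment_space m =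
     restrict_space (\<Pi>\<^sub>M e\<in>{1..m} \<times> {1..m}. borel) (judgments m)"

definition pairwise_loss :: "nat \<Rightarrow> (nat \<Rightarrow> real) \<Rightarrow> (nat \<times> nat \<Rightarrow> real) \<Rightarrow> real" where
  "pairwise_loss m \<alpha> Y =
     (\<Sum>(i, j) | i \<in> {1..m} \<and> j \<in> {1..m} \<and> i < j. Y (i, j) * of_bool (\<alpha> i \<le> \<alpha> j)) +
     (\<Sum>(i, j) | i \<in> {1..m} \<and> j \<in> {1..m} \<and> i > j. Y (i, j) * of_bool (\<alpha> i < \<alpha> j))"

definition margin_surrogate ::
    "nat \<Rightarrow> (real \<Rightarrow> real) \<Rightarrow> (real \<Rightarrow> real) \<Rightarrow> (nat \<Rightarrow> real) \<Rightarrow> (nat \<times> nat \<Rightarrow> real) \<Rightarrow> real" where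
  "margin_surrogate m \<phi> h \<alpha> Y =
     (\<Sum>(i, j) | i \<in> {1..m} \<and> j \<in> {1..m} \<and> Y (i, j) > 0. \<phi> (\<alpha> i - \<alpha> j - h (Y (i, j))))"

text \<open>
  The function \<open>h\<close> in the surrogate loss need not be Borel measurable, so expected losses are
  integrals with respect to the completion of \<open>\<mu>\<close>. For measurable integrands this is the
  integral with respect to \<open>\<mu>\<close>; if \<open>\<mu>\<close> is finitely supported, every function is integrable.
\<close>

definition risk ::
    "((nat \<Rightarrow> real) \<Rightarrow> (nat \<times> nat \<Rightarrow> real) \<Rightarrow> real) \<Rightarrow> (nat \<times> nat \<Rightarrow> real) measure
      \<Rightarrow> (nat \<Rightarrow> real) \<Rightarrow> real" where
  "risk loss \<mu> \<alpha> = (\<integral>Y. loss \<alpha> Y \<partial>completion \<mu>)"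

definition diff_weight :: "(nat \<times> nat \<Rightarrow> real) measure \<Rightarrow> nat \<Rightarrow> nat \<Rightarrow> real" where
  "diff_weight \<mu> i j = (\<integral>Y. Y (i, j) \<partial>\<mu>) - (\<integral>Y. Y (j, i) \<partial>\<mu>)"

definition diff_graph :: "nat \<Rightarrow> (nat \<times> nat \<Rightarrow> real) measure \<Rightarrow> (nat \<times> nat) set" where
  "diff_graph m \<mu> =
     {(i, j) \<in> {1..m} \<times> {1..m}. (\<integral>Y. Y (i, j) \<partial>\<mu>) > (\<integral>Y. Y (j, i) \<partial>\<mu>)}"

definition low_noise :: "nat \<Rightarrow> (nat \<times> nat \<Rightarrow> real) measure \<Rightarrow> bool" where
  "low_noise m \<mu> \<longleftrightarrow>
     (\<forall>i j k. (i, j) \<in> diff_graph m \<mu> \<longrightarrow> (j, k) \<in> diff_graph m \<mu> \<longrightarrow>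
        diff_weight \<mu> i k \<ge> diff_weight \<mu> i j + diff_weight \<mu> j k)"

text \<open>
  Probability measures for which the mean judgment and both expected losses are well defined and
  finite. (Integrability of the entries of \<open>Y\<close> implies that of the pairwise loss.) Without these
  conditions the Bochner integral would silently be \<open>0\<close>.
\<close>

definition admissible ::
    "nat \<Rightarrow> ((nat \<Rightarrow> real) \<Rightarrow> (nat \<times> nat \<Rightarrow> real) \<Rightarrow> real) \<Rightarrow> (nat \<times> nat \<Rightarrow> real) measure
      \<Rightarrow> bool" where
  "admissible m surrogate \<mu> \<longleftrightarrow>
     prob_space \<mu> \<and> sets \<mu> = sets (judgment_space m) \<and>
     (\<forall>e \<in> {1..m} \<times> {1..m}. integrable \<mu> (\<lambda>Y. Y e)) \<and>
     (\<forall>\<alpha> \<in> scores m. integrable (completion \<mu>) (surrogate \<alpha>))"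

text \<open>The infima are taken in \<^typ>\<open>ereal\<close>, where the infimum of the empty set is \<open>\<infinity>\<close>.\<close>

definition strict_separation ::
    "nat \<Rightarrow> ((nat \<Rightarrow> real) \<Rightarrow> (nat \<times> nat \<Rightarrow> real) \<Rightarrow> real)
      \<Rightarrow> ((nat \<Rightarrow> real) \<Rightarrow> (nat \<times> nat \<Rightarrow> real) \<Rightarrow> real) \<Rightarrow> (nat \<times> nat \<Rightarrow> real) measure
      \<Rightarrow> bool" where
  "strict_separation m loss surrogate \<mu> \<longleftrightarrow>
     (INF \<alpha>\<in>scores m. ereal (risk surrogate \<mu> \<alpha>)) <
     (INF \<alpha>\<in>{\<alpha> \<in> scores m. \<not> is_arg_min (risk loss \<mu>) (\<lambda>\<alpha>'. \<alpha>' \<in> scores m) \<alpha>}.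
        ereal (risk surrogate \<mu> \<alpha>))"

end

theory Submission
  imports Defs
begin

text \<open>
  Only edge weights \<open>0\<close> and \<open>1\<close> are needed, so that \<open>h\<close> enters only through
  \<open>\<psi> t = \<phi> (t - h 1)\<close>. Draw a graph with a single edge: \<open>1 \<rightarrow> 3\<close>, \<open>3 \<rightarrow> 1\<close>, \<open>2 \<rightarrow> 3\<close>, \<open>1 \<rightarrow> 2\<close>
  with probabilities \<open>8/16, 3/16, 4/16, 1/16\<close>. The net weights \<open>5 \<ge> 4 + 1\<close> are low-noise, and the
  pairwise risk is minimal exactly when \<open>\<alpha>\<^sub>1 > \<alpha>\<^sub>2 > \<alpha>\<^sub>3\<close>. But the surrogate is always at least as
  happy with a tie \<open>\<alpha>\<^sub>1 = \<alpha>\<^sub>2\<close>: the opposing edge \<open>3 \<rightarrow> 1\<close> pulls \<open>\<alpha>\<^sub>1 - \<alpha>\<^sub>3\<close> down to some level \<open>u\<close>,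
  the edge \<open>2 \<rightarrow> 3\<close> pushes \<open>\<alpha>\<^sub>2 - \<alpha>\<^sub>3\<close> up to \<open>u\<close>, and the edge \<open>1 \<rightarrow> 2\<close> is too light to resist.
  If \<open>k < 0\<close> is a subgradient of \<open>\<psi>\<close> at \<open>0\<close>, then \<open>u\<close> is a point with subgradient \<open>k/4\<close>; it exists
  because \<open>\<psi>\<close> is bounded below. If there is a subgradient \<open>k \<ge> 0\<close> at \<open>0\<close>, then \<open>u = 0\<close> works.
\<close>

section \<open>Slopes and subgradients of convex functions on the line\<close>

lemma convex_on_exists_subgradient:
  fixes f :: "real \<Rightarrow> real"
  assumes "convex_on UNIV f"
  obtains k where "\<And>t. f t \<ge> f x + k * (t - x)"
  using convex_le_Inf_differential[OF assms, of x] by auto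

text \<open>\<open>b\<close> and \<open>c\<close> lie between \<open>a\<close> and \<open>d\<close>
  with mirrored weights \<open>l\<close> and \<open>1 - l\<close>, so the two convexity bounds add
  up to \<open>f b + f c \<le> f a + f d\<close>.\<close>

lemma convex_on_increment_mono:
  fixes f :: "real \<Rightarrow> real"
  assumes f: "convex_on UNIV f" and "a \<le> b" "c \<le> d" "b - a = d - c" "a \<le> c"
  shows "f b - f a \<le> f d - f c"
proof -
  obtain p where p: "\<And>t. f t \<ge> f b + p * (t - b)"
    using convex_on_exists_subgradient[OF f] by blast
  obtain q where q: "\<And>t. f t \<ge> f c + q * (t - c)"
    using convex_on_exists_subgradient[OF f] by blast
  show ?thesis
  proof (cases "a = b \<or> a = c")
    case True
    then show ?thesis using assms by auto
  next
    case False
    define l where "l = (b - a) / (d - a)"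
    have d: "a < b" "a < c" "a < d" using False assms by auto
    have l: "0 \<le> l" "l \<le> 1" unfolding l_def using d assms by (auto simp: divide_simps)
    have e1: "l * (d - a) = b - a" unfolding l_def using d by simp
    then have b: "b = (1 - l) * a + l * d" by (simp add: algebra_simps)
    have c: "c = l * a + (1 - l) * d" using e1 assms by (simp add: algebra_simps)
    have "f b \<le> (1 - l) * f a + l * f d"
      using convex_onD[OF f l, of a d] b by simp
    moreover have "f c \<le> l * f a + (1 - l) * f d"
      using convex_onD[OF f, of "1 - l" a d] l c by simp
    ultimately show ?thesis by (simp add: algebra_simps)
  qed
qed

text \<open>Sliding the interval right until it ends at \<open>u\<close> does not decrease the
  increment, and there the subgradient bounds it.\<close>

lemma convex_on_increment_le:
  fixes f :: "real \<Rightarrow> real"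
  assumes "\<And>t. f t \<ge> f u + k * (t - u)" "convex_on UNIV f" "x \<le> y" "y \<le> u"
  shows "f y - f x \<le> k * (y - x)"
  using convex_on_increment_mono[OF assms(2), of x y "u - (y - x)" u] assms(1)[of "u - (y - x)"] assms(3-)
  by (simp add: algebra_simps)

lemma convex_on_increment_ge:
  fixes f :: "real \<Rightarrow> real"
  assumes "\<And>t. f t \<ge> f u + k * (t - u)" "convex_on UNIV f" "x \<le> y" "u \<le> x"
  shows "k * (y - x) \<le> f y - f x"
  using convex_on_increment_mono[OF assms(2), of u "u + (y - x)" x y] assms(1)[of "u + (y - x)"] assms(3-)
  by (simp add: algebra_simps)

text \<open>Take \<open>u\<close> minimizing \<open>f t - l * t\<close>. Left of \<open>0\<close>
  the subgradient \<open>k < l\<close> keeps this at least \<open>f 0\<close>; right of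
  \<open>T\<close> nonnegativity of \<open>f\<close> does, as \<open>- l * T = f 0\<close>. So a
  minimizer on the compact \<open>{0..T}\<close> is global.\<close>

lemma convex_on_exists_point_with_subgradient:
  fixes f :: "real \<Rightarrow> real"
  assumes f: "convex_on UNIV f" and nonneg: "\<And>t. f t \<ge> 0"
    and k: "\<And>t. f t \<ge> f 0 + k * t" and "k < l" "l < 0"
  obtains u where "u \<ge> 0" "\<And>t. f t \<ge> f u + l * (t - u)"
proof -
  define T where "T = f 0 / (- l)"
  have T: "T \<ge> 0" unfolding T_def using nonneg[of 0] \<open>l < 0\<close> by (simp add: divide_simps)
  have "continuous_on UNIV f" using convex_on_continuous[OF _ f] by simp
  then have "continuous_on {0..T} (\<lambda>t. f t - l * t)"
    by (intro continuous_intros) (auto intro: continuous_on_subset)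
  then obtain u where u: "u \<in> {0..T}" "\<And>t. t \<in> {0..T} \<Longrightarrow> f u - l * u \<le> f t - l * t"
    using continuous_attains_inf[of "{0..T}" "\<lambda>t. f t - l * t"] T by auto
  have u0: "f u - l * u \<le> f 0" using u(2)[of 0] T by simp
  have "f u - l * u \<le> f t - l * t" for t
  proof -
    consider "t < 0" | "t \<in> {0..T}" | "t > T" by fastforce
    then show ?thesis
    proof cases
      case 1
      then have "k * t \<ge> l * t" using \<open>k < l\<close> by (simp add: mult_right_mono_neg)
      then show ?thesis using k[of t] u0 by simp
    next
      case 3
      have "f 0 = - l * T" unfolding T_def using \<open>l < 0\<close> by simp
      also have "\<dots> \<le> - l * t" using 3 \<open>l < 0\<close> by (intro mult_left_mono) auto
      finally show ?thesis using u0 nonneg[of t] by simp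
    qed (use u in auto)
  qed
  then have "f t \<ge> f u + l * (t - u)" for t
    unfolding right_diff_distrib by (smt (verit))
  then show thesis using u(1) by (intro that[of u]) auto
qed

section \<open>The tie inequality\<close>

lemma tie_not_worse:
  fixes \<psi> :: "real \<Rightarrow> real"
  assumes f: "convex_on UNIV \<psi>" and nonneg: "\<And>t. \<psi> t \<ge> 0" and xy: "x > y" "y > 0"
  obtains u where "8 * \<psi> u + 3 * \<psi> (- u) + 4 * \<psi> u + \<psi> 0 \<le>
    8 * \<psi> x + 3 * \<psi> (- x) + 4 * \<psi> y + \<psi> (x - y)"
proof -
  obtain k where k: "\<And>t. \<psi> t \<ge> \<psi> 0 + k * (t - 0)"
    using convex_on_exists_subgradient[OF f, of 0] by blast
  show thesis
  proof (cases "k \<ge> 0")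
    case True
    \<comment> \<open>The weighted subgradient bounds add up to
      \<open>16 * \<psi> 0 + k * (6 * x + 3 * y)\<close>.\<close>
    have "k * x \<ge> 0" "k * y \<ge> 0" using True xy by simp_all
    then show ?thesis
      using k[of x] k[of "-x"] k[of y] k[of "x - y"] that[of 0] by (simp add: algebra_simps)
  next
    case False
    have "\<psi> t \<ge> \<psi> 0 + k * t" for t using k[of t] by simp
    moreover have "k < k / 4" "k / 4 < 0" using False by simp_all
    ultimately obtain u where u: "u \<ge> 0" and su: "\<And>t. \<psi> t \<ge> \<psi> u + (k / 4) * (t - u)"
      using convex_on_exists_point_with_subgradient[OF f nonneg] by metis
    \<comment> \<open>\<open>v\<close> is \<open>u\<close> clamped to \<open>[y, x]\<close>:
      lowering \<open>x\<close> by \<open>a\<close> stays right of \<open>u\<close> and raising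
      \<open>y\<close> by \<open>b\<close> stays left of it, unless the move is empty.\<close>
    define v where "v = min x (max u y)"
    define a b where "a = x - v" and "b = v - y"
    have ab: "a \<ge> 0" "b \<ge> 0" unfolding a_def b_def v_def using xy by auto
    have ka: "k * a \<le> 0" using ab False by (simp add: mult_nonpos_nonneg)
    \<comment> \<open>Closing the gap \<open>a + b\<close> costs at most
      \<open>- k * (a + b)\<close> on the edge \<open>1 \<rightarrow> 2\<close>; each of the two
      moves earns its share.\<close>
    have c: "\<psi> (x - y) \<ge> \<psi> 0 + k * a + k * b"
      using k[of "x - y"] by (simp add: a_def b_def algebra_simps)
    have "4 * \<psi> y \<ge> 4 * \<psi> v - k * b"
    proof (cases "y \<le> u")
      case True
      then show ?thesis
        using convex_on_increment_le[OF su f, of y v] xy by (simp add: b_def v_def)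
    qed (use xy in \<open>simp add: b_def v_def\<close>)
    \<comment> \<open>The eight copies lose at most \<open>- 2 * k * a\<close> (slopes at least
      \<open>k / 4\<close> right of \<open>u\<close>), and the three gain at least
      \<open>- 3 * k * a\<close> (slopes at most \<open>k\<close> left of \<open>0\<close>).\<close>
    moreover have "8 * \<psi> x + 3 * \<psi> (- x) \<ge> 8 * \<psi> v + 3 * \<psi> (- v) - k * a"
    proof (cases "u \<le> x")
      case True
      then have "k / 4 * a \<le> \<psi> x - \<psi> v"
        using convex_on_increment_ge[OF su f, of v x] xy by (simp add: a_def v_def)
      moreover have "\<psi> (- v) - \<psi> (- x) \<le> k * a"
        using convex_on_increment_le[OF k f, of "- x" "- v"] True xy u
        by (simp add: a_def v_def)
      ultimately show ?thesis by simp
    qed (use xy in \<open>simp add: a_def v_def\<close>)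
    ultimately show ?thesis using c that[of v] by simp
  qed
qed

section \<open>Integrals over finitely supported distributions\<close>

text \<open>\<open>f\<close> may be non-measurable, as \<open>h\<close> is arbitrary. It agrees with
  the measurable \<open>s\<close> on the finite support, whose complement is null, so it is
  measurable for the completion.\<close>

lemma
  fixes f :: "'b \<Rightarrow> real"
  assumes fin: "finite (set_pmf p)" and g: "\<And>x. g x \<in> space M"
    and sing: "\<And>x. x \<in> set_pmf p \<Longrightarrow> {g x} \<in> sets M"
  shows integrable_completion_distr_pmf: "integrable (completion (distr (measure_pmf p) M g)) f"
    and integral_completion_distr_pmf:
      "(\<integral>y. f y \<partial>completion (distr (measure_pmf p) M g)) = measure_pmf.expectation p (\<lambda>x. f (g x))"
proof -
  define D where "D = distr (measure_pmf p) M g"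
  define A where "A = g ` set_pmf p"
  define s where "s = (\<lambda>y. \<Sum>a\<in>A. f a * indicator {a} y)"
  have gm [measurable]: "g \<in> measurable (measure_pmf p) M" using g by simp
  have finA: "finite A" using fin by (simp add: A_def)
  have singA: "{a} \<in> sets M" if "a \<in> A" for a using that sing by (auto simp: A_def)
  have A: "A \<in> sets M"
  proof -
    have "(\<Union>a\<in>A. {a}) \<in> sets M" using finA singA by (intro sets.finite_UN) auto
    then show ?thesis by simp
  qed
  have s [measurable]: "s \<in> borel_measurable M"
    unfolding s_def using singA by (intro borel_measurable_sum borel_measurable_times) auto
  have sf: "s y = f y" if "y \<in> A" for y
    unfolding s_def using that finA by (simp add: indicator_def if_distrib cong: if_cong)
  have "{y \<in> space M. y \<in> A} = A" using sets.sets_into_space[OF A] by blast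
  then have "AE y in D. y \<in> A"
    unfolding D_def using A by (subst AE_distr_iff) (auto simp: AE_measure_pmf_iff A_def g)
  then have ae: "AE y in completion D. s y = f y"
    by (intro AE_completion) (auto simp: sf)
  have sD: "s \<in> borel_measurable D" by (simp add: D_def)
  then have sc: "s \<in> borel_measurable (completion D)" by (rule measurable_completion)
  have fc: "f \<in> borel_measurable (completion D)"
  proof (rule measurableI)
    fix B :: "real set" assume "B \<in> sets borel"
    then have "s -` B \<inter> space (completion D) \<in> sets (completion D)"
      using sc by (rule measurable_sets[rotated])
    moreover have "AE y in completion D.
        y \<in> s -` B \<inter> space (completion D) \<longleftrightarrow> y \<in> f -` B \<inter> space (completion D)"
      using ae by auto
    ultimately show "f -` B \<inter> space (completion D) \<in> sets (completion D)"
      using completion.in_sets_AE by blast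
  qed simp
  have "integrable D s"
    unfolding D_def by (subst integrable_distr_eq) (use fin g in \<open>auto intro: integrable_measure_pmf_finite\<close>)
  then have "integrable (completion D) s" using integrable_completion[OF sD] by blast
  then show "integrable (completion (distr (measure_pmf p) M g)) f"
    using integrable_cong_AE[OF sc fc ae] by (simp add: D_def)
  have "(\<integral>y. f y \<partial>completion D) = (\<integral>y. s y \<partial>completion D)"
    using integral_cong_AE[OF sc fc ae] by simp
  also have "\<dots> = (\<integral>y. s y \<partial>D)" using integral_completion[OF sD] .
  also have "\<dots> = measure_pmf.expectation p (\<lambda>x. s (g x))"
    unfolding D_def using gm s by (rule integral_distr)
  also have "\<dots> = measure_pmf.expectation p (\<lambda>x. f (g x))"
    by (intro integral_cong_AE) (auto simp: AE_measure_pmf_iff A_def sf)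
  finally show "(\<integral>y. f y \<partial>completion (distr (measure_pmf p) M g)) =
      measure_pmf.expectation p (\<lambda>x. f (g x))" by (simp add: D_def)
qed

section \<open>Judgments with a single edge\<close>

text \<open>A loop \<open>e = (i, i)\<close> is mapped to the zero judgment.\<close>

definition edge_judgment :: "nat \<Rightarrow> nat \<times> nat \<Rightarrow> nat \<times> nat \<Rightarrow> real" where
  "edge_judgment m e = (\<lambda>x\<in>{1..m} \<times> {1..m}. of_bool (x = e \<and> fst e \<noteq> snd e))"

lemma edge_judgment_in_judgments: "edge_judgment m e \<in> judgments m"
proof -
  have "{x \<in> {1..m} \<times> {1..m}. edge_judgment m e x > 0} \<subseteq> (if fst e \<noteq> snd e then {e} else {})"
    by (auto simp: edge_judgment_def split: if_splits)
  moreover have "acyclic (if fst e \<noteq> snd e then {e} else {})"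
    using trancl_insert[of "fst e" "snd e" "{}"] by (auto simp: acyclic_def)
  ultimately have "acyclic {x \<in> {1..m} \<times> {1..m}. edge_judgment m e x > 0}"
    by (rule acyclic_subset[rotated])
  then show ?thesis by (auto simp: judgments_def edge_judgment_def)
qed

lemma space_judgment_space: "space (judgment_space m) = judgments m"
  by (auto simp: judgment_space_def space_restrict_space space_PiM judgments_def PiE_def)

text \<open>Makes finite supports measurable; a point is a box with singleton sides.\<close>

lemma singleton_in_sets_judgment_space:
  assumes "Y \<in> judgments m"
  shows "{Y} \<in> sets (judgment_space m)"
proof -
  have "(\<Pi>\<^sub>E e\<in>{1..m} \<times> {1..m}. {Y e}) = {Y}"
    using assms by (intro PiE_singleton) (auto simp: judgments_def PiE_def)
  then have "{Y} \<in> sets (\<Pi>\<^sub>M e\<in>{1..m} \<times> {1..m}. borel)"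
    using sets_PiM_I_finite[of "{1..m} \<times> {1..m}" "\<lambda>e. {Y e}" "\<lambda>_. borel"] by simp
  moreover have "{Y} = judgments m \<inter> {Y}" using assms by auto
  ultimately show ?thesis
    unfolding judgment_space_def sets_restrict_space by blast
qed

lemma measurable_judgment_entry:
  assumes "e \<in> {1..m} \<times> {1..m}"
  shows "(\<lambda>Y. Y e) \<in> borel_measurable (judgment_space m)"
  unfolding judgment_space_def
  by (rule measurable_restrict_space1[OF measurable_component_singleton[OF assms]])

lemma pairwise_loss_edge_judgment:
  assumes "a \<in> {1..m}" "b \<in> {1..m}" "a \<noteq> b"
  shows "pairwise_loss m \<alpha> (edge_judgment m (a, b)) =
    of_bool (if a < b then \<alpha> a \<le> \<alpha> b else \<alpha> a < \<alpha> b)"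
proof -
  \<comment> \<open>Covers both halves of the loss, with \<open>R\<close> as \<open><\<close> and as
    \<open>>\<close>; exactly one half contains \<open>(a, b)\<close>.\<close>
  have eq: "(\<Sum>(i, j) | i \<in> {1..m} \<and> j \<in> {1..m} \<and> R i j.
      edge_judgment m (a, b) (i, j) * of_bool (P i j)) = (of_bool (R a b \<and> P a b) :: real)"
    for R P :: "nat \<Rightarrow> nat \<Rightarrow> bool"
  proof -
    have "finite {(i, j). i \<in> {1..m} \<and> j \<in> {1..m} \<and> R i j}"
      by (rule finite_subset[of _ "{1..m} \<times> {1..m}"]) auto
    moreover have "(\<Sum>(i, j) | i \<in> {1..m} \<and> j \<in> {1..m} \<and> R i j.
        edge_judgment m (a, b) (i, j) * of_bool (P i j)) =
      (\<Sum>x | fst x \<in> {1..m} \<and> snd x \<in> {1..m} \<and> R (fst x) (snd x).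
        if x = (a, b) then of_bool (P a b) else (0 :: real))"
      using assms by (intro sum.cong) (auto simp: edge_judgment_def)
    ultimately show ?thesis using assms by (simp add: case_prod_beta')
  qed
  show ?thesis unfolding pairwise_loss_def eq using assms(3) by auto
qed

lemma margin_surrogate_edge_judgment:
  assumes "a \<in> {1..m}" "b \<in> {1..m}" "a \<noteq> b"
  shows "margin_surrogate m \<phi> h \<alpha> (edge_judgment m (a, b)) = \<phi> (\<alpha> a - \<alpha> b - h 1)"
proof -
  have "{(i, j). i \<in> {1..m} \<and> j \<in> {1..m} \<and> edge_judgment m (a, b) (i, j) > 0} = {(a, b)}"
    using assms by (auto simp: edge_judgment_def split: if_splits)
  then show ?thesis using assms by (simp add: margin_surrogate_def edge_judgment_def)
qed

section \<open>The counterexample measure\<close>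

text \<open>The weights let the single slope \<open>k / 4\<close> serve both moves in
  \<open>tie_not_worse\<close>: \<open>4 / 4 = 1\<close> and \<open>3 - 8 / 4 = 1\<close>.\<close>

definition tie_pmf :: "(nat \<times> nat) pmf" where
  "tie_pmf = pmf_of_list [((1, 3), 8/16), ((3, 1), 3/16), ((2, 3), 4/16), ((1, 2), 1/16)]"

definition tie_measure :: "(nat \<times> nat \<Rightarrow> real) measure" where
  "tie_measure = distr (measure_pmf tie_pmf) (judgment_space 3) (edge_judgment 3)"

lemma pmf_tie_pmf:
  "pmf tie_pmf e = (if e = (1, 3) then 8/16 else if e = (3, 1) then 3/16
    else if e = (2, 3) then 4/16 else if e = (1, 2) then 1/16 else 0)"
  unfolding tie_pmf_def by (subst pmf_pmf_of_list) (auto simp: pmf_of_list_wf_def)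

lemma set_tie_pmf: "set_pmf tie_pmf = {(1, 3), (3, 1), (2, 3), (1, 2)}"
  by (auto simp: set_pmf_eq pmf_tie_pmf split: if_splits)

lemma tie_measure_facts:
  "finite (set_pmf tie_pmf)" "edge_judgment 3 e \<in> space (judgment_space 3)"
  "{edge_judgment 3 e} \<in> sets (judgment_space 3)"
  by (simp_all add: set_tie_pmf space_judgment_space edge_judgment_in_judgments
      singleton_in_sets_judgment_space)

lemma integrable_completion_tie_measure: "integrable (completion tie_measure) (f :: _ \<Rightarrow> real)"
  unfolding tie_measure_def by (intro integrable_completion_distr_pmf tie_measure_facts)

lemma risk_tie_measure:
  "risk loss tie_measure \<alpha> =
    (8 * loss \<alpha> (edge_judgment 3 (1, 3)) + 3 * loss \<alpha> (edge_judgment 3 (3, 1)) +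
     4 * loss \<alpha> (edge_judgment 3 (2, 3)) + loss \<alpha> (edge_judgment 3 (1, 2))) / 16"
proof -
  have "risk loss tie_measure \<alpha> = measure_pmf.expectation tie_pmf (\<lambda>e. loss \<alpha> (edge_judgment 3 e))"
    unfolding risk_def tie_measure_def by (intro integral_completion_distr_pmf tie_measure_facts)
  also have "\<dots> = (\<Sum>e\<in>{(1, 3), (3, 1), (2, 3), (1, 2)}. loss \<alpha> (edge_judgment 3 e) * pmf tie_pmf e)"
    by (intro integral_measure_pmf_real) (auto simp: set_tie_pmf)
  also have "\<dots> = (8 * loss \<alpha> (edge_judgment 3 (1, 3)) + 3 * loss \<alpha> (edge_judgment 3 (3, 1)) +
     4 * loss \<alpha> (edge_judgment 3 (2, 3)) + loss \<alpha> (edge_judgment 3 (1, 2))) / 16"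
    by (simp add: pmf_tie_pmf field_simps)
  finally show ?thesis .
qed

lemma pairwise_risk_tie_measure:
  "risk (pairwise_loss 3) tie_measure \<alpha> =
    (8 * of_bool (\<alpha> 1 \<le> \<alpha> 3) + 3 * of_bool (\<alpha> 3 < \<alpha> 1) +
     4 * of_bool (\<alpha> 2 \<le> \<alpha> 3) + of_bool (\<alpha> 1 \<le> \<alpha> 2)) / 16"
  unfolding risk_tie_measure by (simp add: pairwise_loss_edge_judgment)

lemma surrogate_risk_tie_measure:
  "risk (margin_surrogate 3 \<phi> h) tie_measure \<alpha> =
    (8 * \<phi> (\<alpha> 1 - \<alpha> 3 - h 1) + 3 * \<phi> (\<alpha> 3 - \<alpha> 1 - h 1) +
     4 * \<phi> (\<alpha> 2 - \<alpha> 3 - h 1) + \<phi> (\<alpha> 1 - \<alpha> 2 - h 1)) / 16"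
  unfolding risk_tie_measure by (simp add: margin_surrogate_edge_judgment)

lemma integrable_entry_tie_measure:
  assumes "e \<in> {1..3} \<times> {1..3}"
  shows "integrable tie_measure (\<lambda>Y. Y e)"
  using integrable_completion[of "\<lambda>Y. Y e" tie_measure] integrable_completion_tie_measure
    measurable_judgment_entry[OF assms] by (simp add: tie_measure_def)

lemma mean_judgment_tie_measure:
  assumes "e \<in> {1..3} \<times> {1..3}"
  shows "(\<integral>Y. Y e \<partial>tie_measure) = pmf tie_pmf e"
proof -
  have "(\<integral>Y. Y e \<partial>tie_measure) = measure_pmf.expectation tie_pmf (\<lambda>x. edge_judgment 3 x e)"
    unfolding tie_measure_def using tie_measure_facts(2)
    by (intro integral_distr measurable_judgment_entry[OF assms]) auto
  also have "\<dots> = (\<Sum>x\<in>set_pmf tie_pmf. edge_judgment 3 x e * pmf tie_pmf x)"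
    by (intro integral_measure_pmf_real) (auto simp: set_tie_pmf)
  also have "\<dots> = (\<Sum>x\<in>set_pmf tie_pmf. if x = e then pmf tie_pmf x else 0)"
    using assms by (intro sum.cong) (auto simp: edge_judgment_def set_tie_pmf)
  also have "\<dots> = pmf tie_pmf e" by (simp add: set_tie_pmf pmf_tie_pmf)
  finally show ?thesis .
qed

lemma admissible_tie_measure: "admissible 3 surrogate tie_measure"
proof -
  have "prob_space tie_measure"
    unfolding tie_measure_def using tie_measure_facts(2)
    by (intro prob_space.prob_space_distr prob_space_measure_pmf) auto
  then show ?thesis
    unfolding admissible_def
    using integrable_entry_tie_measure integrable_completion_tie_measure
    by (auto simp: tie_measure_def)
qed

lemma low_noise_tie_measure: "low_noise 3 tie_measure"
proof -
  \<comment> \<open>The only composable edges are \<open>1 \<rightarrow> 2 \<rightarrow> 3\<close>,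
    where the low-noise bound is an equality.\<close>
  have "diff_graph 3 tie_measure = {(1, 2), (1, 3), (2, 3)}"
    by (auto simp: diff_graph_def mean_judgment_tie_measure pmf_tie_pmf split: if_splits)
  then show ?thesis
    by (auto simp: low_noise_def diff_weight_def mean_judgment_tie_measure pmf_tie_pmf)
qed

text \<open>A decreasing vector pays only the 3 for \<open>3 \<rightarrow> 1\<close>. A minimizer
  thus cannot pay 8, so it pays this 3 and has no room for the 4 or the 1.\<close>

lemma pairwise_argmin_tie_measure:
  assumes "is_arg_min (risk (pairwise_loss 3) tie_measure) (\<lambda>\<alpha>'. \<alpha>' \<in> scores 3) \<alpha>"
  shows "\<alpha> 1 > \<alpha> 2" "\<alpha> 2 > \<alpha> 3"
proof -
  define \<beta> :: "nat \<Rightarrow> real" where "\<beta> = (\<lambda>i\<in>{1..3}. - real i)"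
  have "\<beta> \<in> scores 3" by (simp add: scores_def \<beta>_def)
  then have "risk (pairwise_loss 3) tie_measure \<alpha> \<le> risk (pairwise_loss 3) tie_measure \<beta>"
    using assms by (auto simp: is_arg_min_linorder)
  also have "\<dots> = 3 / 16"
    unfolding pairwise_risk_tie_measure by (simp add: \<beta>_def)
  finally show "\<alpha> 1 > \<alpha> 2" "\<alpha> 2 > \<alpha> 3"
    unfolding pairwise_risk_tie_measure by (auto simp: of_bool_def split: if_splits)
qed

theorem theorem3:
  fixes h \<phi> :: "real \<Rightarrow> real"
  assumes "convex_on UNIV \<phi>"
    and "\<And>x. \<phi> x \<ge> 0"
  shows "\<exists>m \<mu>. admissible m (margin_surrogate m \<phi> h) \<mu> \<and> low_noise m \<mu> \<and>
    \<not> strict_separation m (pairwise_loss m) (margin_surrogate m \<phi> h) \<mu>"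
proof -
  define \<psi> where "\<psi> t = \<phi> (t - h 1)" for t
  let ?argmin = "is_arg_min (risk (pairwise_loss 3) tie_measure) (\<lambda>\<alpha>'. \<alpha>' \<in> scores 3)"
  let ?R = "risk (margin_surrogate 3 \<phi> h) tie_measure"
  have \<psi>: "convex_on UNIV \<psi>"
  proof (rule convex_onI)
    fix t x y :: real
    assume "0 < t" "t < 1"
    then show "\<psi> ((1 - t) *\<^sub>R x + t *\<^sub>R y) \<le> (1 - t) * \<psi> x + t * \<psi> y"
      using convex_onD[OF assms(1), of t "x - h 1" "y - h 1"]
      by (simp add: \<psi>_def algebra_simps)
  qed simp
  have nonneg: "\<psi> t \<ge> 0" for t using assms(2) by (simp add: \<psi>_def)
  \<comment> \<open>Matching every score vector by a non-minimizer compares the infima whether or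
    not they are attained.\<close>
  have "\<exists>\<beta>\<in>scores 3. \<not> ?argmin \<beta> \<and> ?R \<beta> \<le> ?R \<alpha>" if "\<alpha> \<in> scores 3" for \<alpha>
  proof (cases "?argmin \<alpha>")
    case True
    then have "\<alpha> 1 - \<alpha> 3 > \<alpha> 2 - \<alpha> 3" "\<alpha> 2 - \<alpha> 3 > 0"
      using pairwise_argmin_tie_measure by auto
    then obtain u where u: "8 * \<psi> u + 3 * \<psi> (- u) + 4 * \<psi> u + \<psi> 0 \<le>
      8 * \<psi> (\<alpha> 1 - \<alpha> 3) + 3 * \<psi> (- (\<alpha> 1 - \<alpha> 3)) + 4 * \<psi> (\<alpha> 2 - \<alpha> 3) + \<psi> (\<alpha> 1 - \<alpha> 3 - (\<alpha> 2 - \<alpha> 3))"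
      using tie_not_worse[OF \<psi> nonneg] by blast
    \<comment> \<open>Only score differences matter, so item 3 sits at \<open>0\<close>; the tie of
      items 1 and 2 excludes \<open>\<beta>\<close> from the argmin.\<close>
    define \<beta> :: "nat \<Rightarrow> real" where "\<beta> = (\<lambda>i\<in>{1..3}. if i = 3 then 0 else u)"
    have "?R \<beta> \<le> ?R \<alpha>"
      using u by (simp add: surrogate_risk_tie_measure \<beta>_def \<psi>_def)
    moreover have "\<not> ?argmin \<beta>"
      using pairwise_argmin_tie_measure(1)[of \<beta>] by (auto simp: \<beta>_def)
    moreover have "\<beta> \<in> scores 3" by (simp add: scores_def \<beta>_def)
    ultimately show ?thesis by blast
  qed (use that in blast)
  then have "(INF \<alpha>\<in>{\<alpha> \<in> scores 3. \<not> ?argmin \<alpha>}. ereal (?R \<alpha>)) \<le> (INF \<alpha>\<in>scores 3. ereal (?R \<alpha>))"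
    by (intro INF_mono) auto
  then have "\<not> strict_separation 3 (pairwise_loss 3) (margin_surrogate 3 \<phi> h) tie_measure"
    by (simp add: strict_separation_def not_less)
  then show ?thesis using admissible_tie_measure low_noise_tie_measure by blast
qed

end
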